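(* In any symmetric group $S_n$ of degree $n$, there exists (1) a left palindromic permutation (LPP), and it is unique; (2) a right palindromic permutation (RPP), and it is unique. But there does not exist a palindromic permutation (PP) in $S_n$.
   Context: $S_n$ is the group of all permutations of $\{1,2,\dots,n\}$ under composition. For $\sigma\in S_n$, the left palindromic value of $\sigma$ is the number $N_\lambda(\sigma)=12\cdots n\,\sigma(n)\cdots\sigma(1)$, obtained by writing $1,2,\dots,n,\sigma(n),\dots,\sigma(1)$ one after another, and the right palindromic value of $\sigma$ is the number $N_\rho(\sigma)=12\cdots n\,\sigma(1)\cdots\sigma(n)$, obtained by writing $1,2,\dots,n,\sigma(1),\dots,\sigma(n)$ one after another. An integer is a palindrome if it reads the same forwards and backwards (for example, $12321$). A permutation $\sigma\in S_n$ is a left palindromic permutation (LPP) if and only if the number $N_\lambda(\sigma)$ is a palindrome, a right palindromic permutation (RPP) if and only if the number $N_\rho(\sigma)$ is a palindrome, and a palindromic permutation (PP) if and only if it is both an LPP and an RPP.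
   Formalization: Numbers are written in any base b > n, so each of 1,…,n is one digit (decimal covers n ≤ 9; in decimal the claim fails e.g. for n = 10), and non-existence of a PP is claimed only for n ≥ 2, since in S_1 both values are 11 and the identity is a PP. *)

theory Defs
  imports "HOL-Algebra.Sym_Groups"
begin

(* The radix b is a parameter; decimal notation is b = 10.  Digits are listed most significant
   first, and 0 is written [0].  The guard b < 2 only makes the function total. *)
fun digits :: "nat \<Rightarrow> nat \<Rightarrow> nat list" where
  "digits b m = (if b < 2 \<or> m < b then [m] else digits b (m div b) @ [m mod b])"

declare digits.simps [simp del]

definition palindrome :: "nat \<Rightarrow> nat \<Rightarrow> bool" where
  "palindrome b m \<longleftrightarrow> rev (digits b m) = digits b m"

(* The number whose radix-b numeral is obtained by writing the radix-b numerals of the members of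
   xs one after another; horner_sum expects the least significant digit first. *)
definition juxtapose :: "nat \<Rightarrow> nat list \<Rightarrow> nat" where
  "juxtapose b xs = horner_sum id b (rev (concat (map (digits b) xs)))"

definition left_palindromic_value :: "nat \<Rightarrow> nat \<Rightarrow> (nat \<Rightarrow> nat) \<Rightarrow> nat" where
  "left_palindromic_value b n \<sigma> = juxtapose b ([1..<Suc n] @ rev (map \<sigma> [1..<Suc n]))"

definition right_palindromic_value :: "nat \<Rightarrow> nat \<Rightarrow> (nat \<Rightarrow> nat) \<Rightarrow> nat" where
  "right_palindromic_value b n \<sigma> = juxtapose b ([1..<Suc n] @ map \<sigma> [1..<Suc n])"

(* LPP, RPP and PP are only meaningful for members of sym_group n. *)
definition LPP :: "nat \<Rightarrow> nat \<Rightarrow> (nat \<Rightarrow> nat) \<Rightarrow> bool" where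
  "LPP b n \<sigma> \<longleftrightarrow> palindrome b (left_palindromic_value b n \<sigma>)"

definition RPP :: "nat \<Rightarrow> nat \<Rightarrow> (nat \<Rightarrow> nat) \<Rightarrow> bool" where
  "RPP b n \<sigma> \<longleftrightarrow> palindrome b (right_palindromic_value b n \<sigma>)"

definition PP :: "nat \<Rightarrow> nat \<Rightarrow> (nat \<Rightarrow> nat) \<Rightarrow> bool" where
  "PP b n \<sigma> \<longleftrightarrow> LPP b n \<sigma> \<and> RPP b n \<sigma>"

end

theory Submission
  imports Defs
begin

text \<open>Since n < b, each entry of 1, ..., n and of its image under \<sigma> is a single digit,
  and the leading entry 1 is nonzero. Hence the digit string of a palindromic value is just the
  juxtaposed list (\<open>digits_juxtapose\<close>, resting on the fact that \<open>digits\<close>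
  inverts Horner evaluation). Such a string of length 2n is a palindrome exactly when its second
  half reverses its first. For LPP the two reversals cancel and \<sigma> is the identity on {1..n};
  for RPP, \<sigma> is i \<mapsto> n + 1 - i. Each prescription determines one permutation, and at 1
  they give 1 and n, which differ once n \<ge> 2; for n = 1 they coincide.\<close>

lemma digits_horner_sum:
  assumes "2 \<le> b" and "ds \<noteq> []" and "hd ds \<noteq> 0" and "\<forall>d\<in>set ds. d < b"
  shows "digits b (horner_sum id b (rev ds)) = ds"
  using assms(2-)
proof (induction ds rule: rev_induct)
  case Nil
  then show ?case by simp
next
  case (snoc d ds)
  show ?case
  proof (cases "ds = []")
    case True
    with snoc.prems show ?thesis by (simp add: digits.simps)
  next
    case False
    let ?m = "horner_sum id b (rev ds)"
    have IH: "digits b ?m = ds" and d: "d < b"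
      using snoc.IH snoc.prems False by (simp_all add: id_def)
    \<comment> \<open>A nonzero prefix value forces d + b * ?m to be at least b, so the recursion of
      \<open>digits\<close> splits off d instead of stopping. Here the nonzero head enters: value 0
      would have the numeral [0].\<close>
    have "?m \<noteq> 0"
    proof
      assume "?m = 0"
      with IH assms(1) have "ds = [0]" by (simp add: digits.simps)
      with snoc.prems False show False by simp
    qed
    then have "\<not> d + b * ?m < b"
      by (cases ?m) auto
    then have "digits b (d + b * ?m) = digits b ((d + b * ?m) div b) @ [(d + b * ?m) mod b]"
      using assms(1) by (subst digits.simps) simp
    also have "\<dots> = ds @ [d]"
      using IH d assms(1) by simp
    finally show ?thesis by (simp add: id_def)
  qed
qed

lemma digits_juxtapose:
  assumes "2 \<le> b" and "xs \<noteq> []" and "hd xs \<noteq> 0" and "\<forall>x\<in>set xs. x < b"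
  shows "digits b (juxtapose b xs) = xs"
proof -
  have "map (digits b) xs = map (\<lambda>x. [x]) xs"
    using assms(4) by (auto simp: digits.simps)
  then have "concat (map (digits b) xs) = xs"
    by (simp only: concat_map_singleton map_ident)
  with digits_horner_sum[OF assms] show ?thesis
    by (simp add: juxtapose_def)
qed

text \<open>Reversing xs @ ys gives rev ys @ rev xs; equal lengths allow comparison half by
  half.\<close>

lemma palindrome_juxtapose_append_iff:
  assumes "2 \<le> b" and "xs \<noteq> []" and "hd xs \<noteq> 0" and "\<forall>x\<in>set xs \<union> set ys. x < b"
    and "length ys = length xs"
  shows "palindrome b (juxtapose b (xs @ ys)) \<longleftrightarrow> ys = rev xs"
proof -
  have "digits b (juxtapose b (xs @ ys)) = xs @ ys"
    using assms by (intro digits_juxtapose) auto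
  then show ?thesis
    using assms(5) by (auto simp: palindrome_def)
qed

context
  fixes n b :: nat and \<sigma> :: "nat \<Rightarrow> nat"
  assumes n: "1 \<le> n" "n < b" and \<sigma>: "\<sigma> permutes {1..n}"
begin

lemma base_ge_2: "2 \<le> b"
  using n by simp

lemma numerals_less_base: "\<forall>x\<in>set [1..<Suc n] \<union> set (map \<sigma> [1..<Suc n]). x < b"
proof -
  have "\<sigma> i \<le> n" if "i \<in> {1..n}" for i
    using permutes_in_image[OF \<sigma>, of i] that by auto
  with n(2) show ?thesis by fastforce
qed

lemma LPP_iff: "LPP b n \<sigma> \<longleftrightarrow> (\<forall>i\<in>{1..n}. \<sigma> i = i)"
proof -
  have "LPP b n \<sigma> \<longleftrightarrow> rev (map \<sigma> [1..<Suc n]) = rev [1..<Suc n]"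
    unfolding LPP_def left_palindromic_value_def
    using n base_ge_2 numerals_less_base by (intro palindrome_juxtapose_append_iff) (auto simp del: upt_Suc)
  also have "\<dots> \<longleftrightarrow> map \<sigma> [1..<Suc n] = map id [1..<Suc n]"
    by (simp del: upt_Suc)
  also have "\<dots> \<longleftrightarrow> (\<forall>i\<in>{1..n}. \<sigma> i = i)"
    unfolding map_eq_conv by (auto simp del: upt_Suc)
  finally show ?thesis .
qed

lemma RPP_iff: "RPP b n \<sigma> \<longleftrightarrow> (\<forall>i\<in>{1..n}. \<sigma> i = Suc n - i)"
proof -
  \<comment> \<open>With the reversal written as a map over the same list, equality of lists becomes
    a pointwise condition on \<sigma>.\<close>
  have rev: "rev [1..<Suc n] = map (\<lambda>i. Suc n - i) [1..<Suc n]"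
    by (rule nth_equalityI) (simp_all add: rev_nth del: upt_Suc)
  have "RPP b n \<sigma> \<longleftrightarrow> map \<sigma> [1..<Suc n] = rev [1..<Suc n]"
    unfolding RPP_def right_palindromic_value_def
    using n base_ge_2 numerals_less_base by (intro palindrome_juxtapose_append_iff) (auto simp del: upt_Suc)
  also have "\<dots> \<longleftrightarrow> (\<forall>i\<in>{1..n}. \<sigma> i = Suc n - i)"
    unfolding rev map_eq_conv by (auto simp del: upt_Suc)
  finally show ?thesis .
qed

end

text \<open>Uniqueness as a function on all naturals: a permutation of S fixes every point outside
  S, so its values on S determine it.\<close>

lemma ex1_permutes_eq_on:
  assumes "f permutes S"
  shows "\<exists>!\<sigma>. \<sigma> permutes S \<and> (\<forall>i\<in>S. \<sigma> i = f i)"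
proof (rule ex1I[of _ f])
  show "\<sigma> = f" if "\<sigma> permutes S \<and> (\<forall>i\<in>S. \<sigma> i = f i)" for \<sigma>
  proof
    fix i
    show "\<sigma> i = f i"
      using that assms by (cases "i \<in> S") (auto simp: permutes_not_in)
  qed
qed (use assms in simp)

lemma reversal_permutes: "(\<lambda>i. if i \<in> {1..n} then Suc n - i else i) permutes {1..n}"
proof (rule bij_imp_permutes)
  show "bij_betw (\<lambda>i. if i \<in> {1..n} then Suc n - i else i) {1..n} {1..n}"
    \<comment> \<open>The reversal is an involution on {1..n}, so it serves as its own inverse
      there.\<close>
    by (rule bij_betw_byWitness[where f' = "\<lambda>i. Suc n - i"]) auto
qed auto

theorem theorem3p1:
  fixes n b :: nat
  assumes "n \<ge> 1" and "n < b"
  shows "(\<exists>!\<sigma> \<in> carrier (sym_group n). LPP b n \<sigma>) \<and>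
         (\<exists>!\<sigma> \<in> carrier (sym_group n). RPP b n \<sigma>) \<and>
         (n \<ge> 2 \<longrightarrow> \<not> (\<exists>\<sigma> \<in> carrier (sym_group n). PP b n \<sigma>))"
proof (intro conjI impI)
  note LPP = LPP_iff[OF assms] and RPP = RPP_iff[OF assms]
  have carrier: "\<sigma> \<in> carrier (sym_group n) \<longleftrightarrow> \<sigma> permutes {1..n}" for \<sigma>
    by (simp add: sym_group_def)
  show "\<exists>!\<sigma> \<in> carrier (sym_group n). LPP b n \<sigma>"
    \<comment> \<open>The characterisation \<open>LPP\<close> is conditional on \<sigma> being a
      permutation; \<open>conj_cong\<close> supplies this from the first conjunct.\<close>
    using ex1_permutes_eq_on[OF permutes_id, of "{1..n}"]
    by (simp add: carrier LPP cong: conj_cong)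
  show "\<exists>!\<sigma> \<in> carrier (sym_group n). RPP b n \<sigma>"
    using ex1_permutes_eq_on[OF reversal_permutes, of n]
    by (simp add: carrier RPP cong: conj_cong)
  show "\<not> (\<exists>\<sigma> \<in> carrier (sym_group n). PP b n \<sigma>)" if "n \<ge> 2"
  proof
    assume "\<exists>\<sigma> \<in> carrier (sym_group n). PP b n \<sigma>"
    then obtain \<sigma> where "\<forall>i\<in>{1..n}. \<sigma> i = i" "\<forall>i\<in>{1..n}. \<sigma> i = Suc n - i"
      by (auto simp: carrier PP_def LPP RPP)
    \<comment> \<open>Together these say n = 1.\<close>
    then have "\<sigma> 1 = 1" "\<sigma> 1 = Suc n - 1"
      using assms(1) by (meson atLeastAtMost_iff order_refl)+
    with that show False by simp
  qed
qed

end
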